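(* Let $n \ge 2$, $N = 2^n$, and let $\eta$ be a bijection from the vertex set $\{0,1\}^n$ of the hypercube $Q_n$ to $\mathbb{Z}_N$. Let $x = \frac{2^n + (-1)^{n+1}}{3}$. Suppose there exist a coordinate $i \in \{1,\dots,n\}$, a value $b \in \{0,1\}$, and an arc $A$ of $2^{n-1}$ consecutive positions of the cycle $\mathbb{Z}_N$ such that at least $x$ vertices $v$ with $v_i = b$ satisfy $\eta(v) \in A$. Then for every routing of the edges of $Q_n$ on the cycle, there is a gap of the cycle through which at least $\frac{5 \cdot 2^{n-2} - 1}{3}$ edges are routed if $n$ is odd, and at least $\frac{5 \cdot 2^{n-2} - 2}{3}$ edges if $n$ is even. In particular, the cyclic cutwidth of $Q_n$ with respect to $\eta$ is at least these values.
   Context: $Q_n$ is the graph on $\{0,1\}^n$ with two vertices adjacent iff they differ in exactly one coordinate. The cycle $\mathbb{Z}_N$ has $N$ gaps, the gap $g_j$ lying between consecutive positions $j$ and $j+1 \pmod N$. A routing assigns to each edge $\{v,w\}$ of $Q_n$ one of the two arcs of the cycle joining $\eta(v)$ and $\eta(w)$; the edge is then said to pass through every gap on that arc. The cut at a gap is the number of edges passing through it, and the cyclic cutwidth $\mathrm{ccw}(Q_n,\eta)$ is the minimum over routings of the maximum cut over all gaps. An arc of $2^{n-1}$ consecutive positions is a set $\{j, j+1, \dots, j+2^{n-1}-1\} \pmod N$. (The hypothesis says there is "at least a $\frac{2^n + (-1)^{n+1}}{3} / \frac{2^{n-1}+(-1)^n}{3}$ split" for a pair of complementary $Q_{n-1}$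 subcubes with respect to a diameter of the cycle.) *)

theory Defs
  imports Complex_Main "HOL-Library.FuncSet"
begin

text \<open>
  A vertex of \<open>Q\<^sub>n\<close> is an extensional function from the coordinates \<open>{1..n}\<close> to \<open>{0, 1}\<close>.
\<close>

definition cube_verts :: "nat \<Rightarrow> (nat \<Rightarrow> nat) set" where
  "cube_verts n = {1..n} \<rightarrow>\<^sub>E {0, 1}"

definition cube_edges :: "nat \<Rightarrow> (nat \<Rightarrow> nat) set set" where
  "cube_edges n =
     {{v, w} | v w. v \<in> cube_verts n \<and> w \<in> cube_verts n \<and> card {i \<in> {1..n}. v i \<noteq> w i} = 1}"

text \<open>
  The positions of the cycle \<open>\<int>\<^sub>N\<close> are represented by \<open>{..<N}\<close>, and the gap between the
  positions \<open>j\<close> and \<open>(j + 1) mod N\<close> is represented by \<open>j\<close>.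
\<close>

definition position_arc :: "nat \<Rightarrow> nat \<Rightarrow> nat \<Rightarrow> nat set" where
  "position_arc N j k = {(j + t) mod N | t. t < k}"

text \<open>
  An arc joining two positions is identified with the set of gaps on it. For \<open>p, q < N\<close>,
  \<open>gap_arc N p q\<close> is the arc traversed from \<open>p\<close> to \<open>q\<close> in increasing direction; its length is
  \<open>q - p\<close> modulo \<open>N\<close>. For \<open>p \<noteq> q\<close> the other arc joining them is \<open>gap_arc N q p\<close>.
\<close>

definition gap_arc :: "nat \<Rightarrow> nat \<Rightarrow> nat \<Rightarrow> nat set" where
  "gap_arc N p q = {(p + t) mod N | t. t < (q + N - p) mod N}"

text \<open>
  Edges are unordered, so \<open>(v, w)\<close> below ranges over both orderings of the end points of \<open>e\<close>,
  which yields both arcs.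
\<close>

definition arcs_joining :: "nat \<Rightarrow> ('a \<Rightarrow> nat) \<Rightarrow> 'a set \<Rightarrow> nat set set" where
  "arcs_joining N \<eta> e = {gap_arc N (\<eta> v) (\<eta> w) | v w. e = {v, w}}"

definition routings :: "nat \<Rightarrow> ((nat \<Rightarrow> nat) \<Rightarrow> nat) \<Rightarrow> ((nat \<Rightarrow> nat) set \<Rightarrow> nat set) set" where
  "routings n \<eta> = (\<Pi>\<^sub>E e\<in>cube_edges n. arcs_joining (2 ^ n) \<eta> e)"

definition gap_cut :: "nat \<Rightarrow> ((nat \<Rightarrow> nat) set \<Rightarrow> nat set) \<Rightarrow> nat \<Rightarrow> nat" where
  "gap_cut n r j = card {e \<in> cube_edges n. j \<in> r e}"

text \<open>
  Routings are extensional, so for a bijection \<open>\<eta>\<close> the set of routings is finite; it is also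
  nonempty, hence \<^const>\<open>Min\<close> is the genuine minimum.
\<close>

definition cyclic_cutwidth :: "nat \<Rightarrow> ((nat \<Rightarrow> nat) \<Rightarrow> nat) \<Rightarrow> nat" where
  "cyclic_cutwidth n \<eta> = Min ((\<lambda>r. Max (gap_cut n r ` {..<2 ^ n})) ` routings n \<eta>)"

end

theory Submission
  imports Defs "HOL-Number_Theory.Cong"
begin

text \<open>
  Rotating the diameter by one position changes the number of vertices of the subcube \<open>v\<^sub>i = b\<close> in
  the half-cycle by at most one, and rotating it by \<open>2\<^sup>n\<^sup>-\<^sup>1\<close> positions exchanges the two halves.
  Hence some diameter realises the split \<open>x / y\<close> with \<open>y = 2\<^sup>n\<^sup>-\<^sup>1 - x\<close> exactly. Let \<open>S\<close> be the set
  of vertices on one side of it. Every edge leaving \<open>S\<close> passes through one of the two gaps at the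
  ends of the diameter, so one of them has a cut of at least half the edge boundary of \<open>S\<close>.
  By edge isoperimetry in each of the two subcubes (in the first one for the complement of \<open>S\<close>),
  together with the edges in direction \<open>i\<close>, the boundary has at least
  \<open>2 ((n - 1) y - 2 E(y)) + (x - y)\<close> edges, where \<open>E(y)\<close> is the maximal number of edges spanned by
  \<open>y\<close> vertices. The number \<open>y\<close> is a Jacobsthal number, for which \<open>E(y)\<close> has a closed form, and the
  bound is exactly twice the claimed one.
\<close>

section \<open>Edge isoperimetry in the cube\<close>

text \<open>
  The maximal number of edges spanned by \<open>k\<close> vertices of a cube: an optimal set splits as evenly as
  possible into two optimal sets in parallel subcubes, joined by \<open>k div 2\<close> edges.
\<close>

fun max_edges :: "nat \<Rightarrow> nat" where
  "max_edges k = (if k \<le> 1 then 0 else max_edges (k div 2) + max_edges ((k + 1) div 2) + k div 2)"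

declare max_edges.simps [simp del]

lemma max_edges_0 [simp]: "max_edges 0 = 0" and max_edges_1 [simp]: "max_edges (Suc 0) = 0"
  by (simp_all add: max_edges.simps)

lemma max_edges_even: "max_edges (2 * k) = 2 * max_edges k + k"
  by (cases "k = 0") (simp_all add: max_edges.simps[of "2 * k"])

lemma max_edges_odd: "max_edges (Suc (2 * k)) = max_edges k + max_edges (Suc k) + k"
  by (cases "k = 0") (simp_all add: max_edges.simps[of "Suc (2 * k)"])

text \<open>This is the recursion behind edge isoperimetry: two parts of sizes \<open>a\<close> and
  \<open>b\<close> in opposite subcubes are joined by at most \<open>min a b\<close> edges. The
  induction splits \<open>a\<close> and \<open>b\<close> by parity and pairs their halves so that
  the sums are the halves of \<open>a + b\<close>.\<close>

lemma max_edges_superadditive: "max_edges a + max_edges b + min a b \<le> max_edges (a + b)"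
proof (induction "a + b" arbitrary: a b rule: less_induct)
  case less
  show ?case
  proof (cases "a = 0 \<or> b = 0")
    case True
    then show ?thesis by auto
  next
    case False
    have IH: "max_edges p + max_edges q + min p q \<le> max_edges (p + q)" if "p + q < a + b" for p q
      using less that by blast
    obtain p where p: "a = 2 * p \<or> a = Suc (2 * p)" by (metis oddE evenE Suc_eq_plus1)
    obtain q where q: "b = 2 * q \<or> b = Suc (2 * q)" by (metis oddE evenE Suc_eq_plus1)
    consider "a = 2 * p" "b = 2 * q" | "a = Suc (2 * p)" "b = 2 * q"
      | "a = 2 * p" "b = Suc (2 * q)" | "a = Suc (2 * p)" "b = Suc (2 * q)"
      using p q by blast
    then show ?thesis
    proof cases
      case 1
      then have "a + b = 2 * (p + q)" by simp
      then have "max_edges (a + b) = 2 * max_edges (p + q) + (p + q)"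
        using max_edges_even by metis
      with 1 IH[of p q] False show ?thesis by (auto simp: max_edges_even)
    next
      case 2
      then have "a + b = Suc (2 * (p + q))" by simp
      then have "max_edges (a + b) = max_edges (p + q) + max_edges (Suc (p + q)) + (p + q)"
        using max_edges_odd by metis
      with 2 IH[of p q] IH[of "Suc p" q] False show ?thesis
        by (auto simp: max_edges_even max_edges_odd min_def split: if_splits)
    next
      case 3
      then have "a + b = Suc (2 * (p + q))" by simp
      then have "max_edges (a + b) = max_edges (p + q) + max_edges (Suc (p + q)) + (p + q)"
        using max_edges_odd by metis
      with 3 IH[of p q] IH[of p "Suc q"] False show ?thesis
        by (auto simp: max_edges_even max_edges_odd min_def split: if_splits)
    next
      \<comment> \<open>The halves are paired crosswise, \<open>p\<close> with \<open>Suc q\<close>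
        and \<open>Suc p\<close> with \<open>q\<close>, since both halves of \<open>a + b\<close>
        equal \<open>Suc (p + q)\<close>.\<close>
      case 4
      then have "a + b = 2 * (Suc (p + q))" by simp
      then have "max_edges (a + b) = 2 * max_edges (Suc (p + q)) + Suc (p + q)"
        using max_edges_even by metis
      with 4 IH[of p "Suc q"] IH[of "Suc p" q] show ?thesis
        by (auto simp: max_edges_odd min_def split: if_splits)
    qed
  qed
qed

text \<open>Edges are handled as pairs of a vertex \<open>v\<close> and a direction
  \<open>i\<close>, with \<open>flip i v\<close> as the other end. On 0/1 values the truncated
  subtraction just swaps 0 and 1.\<close>

definition flip :: "nat \<Rightarrow> (nat \<Rightarrow> nat) \<Rightarrow> nat \<Rightarrow> nat" where
  "flip i v = v(i := 1 - v i)"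

lemma cube_vertsD: "v \<in> cube_verts n \<Longrightarrow> i \<in> {1..n} \<Longrightarrow> v i = 0 \<or> v i = 1"
  unfolding cube_verts_def by (drule PiE_mem) auto

lemma finite_cube_verts [simp]: "finite (cube_verts n)"
  by (simp add: cube_verts_def finite_PiE)

lemma flip_in_cube:
  assumes "v \<in> cube_verts n" "i \<in> {1..n}"
  shows "flip i v \<in> cube_verts n"
  unfolding cube_verts_def
proof (rule PiE_I)
  fix k assume "k \<in> {1..n}"
  then show "flip i v k \<in> {0, 1}"
    using cube_vertsD[OF assms] cube_vertsD[OF assms(1), of k] by (auto simp: flip_def)
next
  fix k assume k: "k \<notin> {1..n}"
  have "v k = undefined" using assms(1) k unfolding cube_verts_def by (rule PiE_arb)
  moreover have "k \<noteq> i" using assms(2) k by blast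
  ultimately show "flip i v k = undefined" by (simp add: flip_def)
qed

lemma flip_other: "j \<noteq> i \<Longrightarrow> flip i v j = v j"
  by (simp add: flip_def)

lemma flip_same: "flip i v i = 1 - v i"
  by (simp add: flip_def)

lemma flip_flip: "v \<in> cube_verts n \<Longrightarrow> i \<in> {1..n} \<Longrightarrow> flip i (flip i v) = v"
  using cube_vertsD[of v n i] by (auto simp: flip_def fun_eq_iff)

text \<open>For disjoint \<open>S\<close> and \<open>T\<close>, both sides count the edges of
  direction \<open>i\<close> between them, each side from a different end.\<close>

lemma card_flip_swap:
  assumes "S \<subseteq> cube_verts n" "T \<subseteq> cube_verts n" "i \<in> {1..n}"
  shows "card {v \<in> S. flip i v \<in> T} = card {v \<in> T. flip i v \<in> S}"
proof (rule bij_betw_same_card)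
  show "bij_betw (flip i) {v \<in> S. flip i v \<in> T} {v \<in> T. flip i v \<in> S}"
    using assms by (intro bij_betw_byWitness[where f' = "flip i"]) (auto simp: flip_flip subset_iff)
qed

text \<open>
  Only the directions in \<open>I\<close> count, so \<open>S\<close> may meet several parallel subcubes; this lets the
  induction on \<open>I\<close> keep the ambient cube fixed.
\<close>

lemma sum_inner_le_max_edges:
  assumes "I \<subseteq> {1..n}" "S \<subseteq> cube_verts n"
  shows "(\<Sum>i\<in>I. card {v \<in> S. flip i v \<in> S}) \<le> 2 * max_edges (card S)"
proof -
  have "finite I" using assms(1) finite_subset by blast
  then show ?thesis using assms
  proof (induction I arbitrary: S rule: finite_induct)
    case empty
    then show ?case by simp
  next
    case (insert i I)
    have i: "i \<in> {1..n}" and I: "I \<subseteq> {1..n}" using insert.prems by auto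
    have fin: "finite S" using insert.prems finite_subset finite_cube_verts by blast
    define S0 where "S0 = {v \<in> S. v i = 0}"
    define S1 where "S1 = {v \<in> S. v i = 1}"
    have sub: "S0 \<subseteq> cube_verts n" "S1 \<subseteq> cube_verts n"
      using insert.prems by (auto simp: S0_def S1_def)
    have fin01: "finite S0" "finite S1" using fin by (auto simp: S0_def S1_def)
    have bin: "v i = 0 \<or> v i = 1" if "v \<in> S" for v
      using cube_vertsD insert.prems i that by blast
    have S: "S = S0 \<union> S1" and disj: "S0 \<inter> S1 = {}"
      using cube_vertsD insert.prems i by (auto simp: S0_def S1_def)
    have cS: "card S = card S0 + card S1"
      using S disj fin01 by (simp add: card_Un_disjoint)
    \<comment> \<open>A flip in direction \<open>j\<close> leaves coordinate \<open>i\<close> alone,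
      so it never moves between \<open>S0\<close> and \<open>S1\<close>.\<close>
    have *: "card {v \<in> S. flip j v \<in> S} =
        card {v \<in> S0. flip j v \<in> S0} + card {v \<in> S1. flip j v \<in> S1}" if "j \<in> I" for j
    proof -
      have "j \<noteq> i" using that insert.hyps by auto
      then have "flip j v \<in> S0 \<longleftrightarrow> flip j v \<in> S \<and> v i = 0"
          "flip j v \<in> S1 \<longleftrightarrow> flip j v \<in> S \<and> v i = 1" for v
        by (auto simp: S0_def S1_def flip_other)
      then have "{v \<in> S. flip j v \<in> S} = {v \<in> S0. flip j v \<in> S0} \<union> {v \<in> S1. flip j v \<in> S1}"
        unfolding S0_def S1_def using bin by blast
      then show ?thesis using fin01 disj by (simp add: card_Un_disjoint disjoint_iff)
    qed
    \<comment> \<open>Direction \<open>i\<close> contributes a matching between \<open>S0\<close>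
      and \<open>S1\<close>; each of its edges is counted from both ends, hence the factor 2 before
      the minimum.\<close>
    have "v i = 0 \<and> flip i v i = 1 \<or> v i = 1 \<and> flip i v i = 0" if "v \<in> S" for v
      using bin[OF that] by (auto simp: flip_same)
    then have "{v \<in> S. flip i v \<in> S} = {v \<in> S0. flip i v \<in> S1} \<union> {v \<in> S1. flip i v \<in> S0}"
      unfolding S0_def S1_def by fastforce
    then have "card {v \<in> S. flip i v \<in> S} \<le>
        card {v \<in> S0. flip i v \<in> S1} + card {v \<in> S1. flip i v \<in> S0}"
      by (simp add: card_Un_le)
    moreover have "card {v \<in> S0. flip i v \<in> S1} \<le> card S0"
        "card {v \<in> S1. flip i v \<in> S0} \<le> card S1"
      using fin01 by (auto intro: card_mono)
    ultimately have i_le: "card {v \<in> S. flip i v \<in> S} \<le> 2 * min (card S0) (card S1)"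
      using card_flip_swap[OF sub i] by linarith
    have "(\<Sum>j\<in>insert i I. card {v \<in> S. flip j v \<in> S}) = card {v \<in> S. flip i v \<in> S} +
        ((\<Sum>j\<in>I. card {v \<in> S0. flip j v \<in> S0}) + (\<Sum>j\<in>I. card {v \<in> S1. flip j v \<in> S1}))"
      using insert.hyps * by (simp add: sum.distrib)
    also have "\<dots> \<le> 2 * min (card S0) (card S1) + (2 * max_edges (card S0) + 2 * max_edges (card S1))"
      using i_le insert.IH[OF I sub(1)] insert.IH[OF I sub(2)] by linarith
    also have "\<dots> \<le> 2 * max_edges (card S)"
      using max_edges_superadditive[of "card S0" "card S1"] cS by simp
    finally show ?case .
  qed
qed

text \<open>Degree count: each vertex of \<open>S\<close> has \<open>card I\<close> flips, which
  either stay in \<open>S\<close> or leave it. Integers are used because the lower bound can be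
  negative.\<close>

lemma sum_boundary_ge:
  assumes "I \<subseteq> {1..n}" "S \<subseteq> cube_verts n"
  shows "int (card I) * int (card S) - 2 * int (max_edges (card S))
    \<le> int (\<Sum>i\<in>I. card {v \<in> S. flip i v \<notin> S})"
proof -
  have fin: "finite S" using assms finite_subset finite_cube_verts by blast
  have "card {v \<in> S. flip i v \<in> S} + card {v \<in> S. flip i v \<notin> S} = card S" for i
  proof -
    have "S = {v \<in> S. flip i v \<in> S} \<union> {v \<in> S. flip i v \<notin> S}" by auto
    moreover have "card ({v \<in> S. flip i v \<in> S} \<union> {v \<in> S. flip i v \<notin> S}) =
        card {v \<in> S. flip i v \<in> S} + card {v \<in> S. flip i v \<notin> S}"
      using fin by (intro card_Un_disjoint) auto
    ultimately show ?thesis by simp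
  qed
  then have "(\<Sum>i\<in>I. card {v \<in> S. flip i v \<in> S}) + (\<Sum>i\<in>I. card {v \<in> S. flip i v \<notin> S}) =
      card I * card S"
    by (simp flip: sum.distrib)
  then have "int (\<Sum>i\<in>I. card {v \<in> S. flip i v \<in> S}) + int (\<Sum>i\<in>I. card {v \<in> S. flip i v \<notin> S}) =
      int (card I) * int (card S)"
    by (simp only: flip: of_nat_add of_nat_mult)
  then show ?thesis using sum_inner_le_max_edges[OF assms] by linarith
qed

section \<open>Jacobsthal numbers\<close>

fun jacobsthal :: "nat \<Rightarrow> nat" where
  "jacobsthal 0 = 0"
| "jacobsthal (Suc 0) = 1"
| "jacobsthal (Suc (Suc m)) = jacobsthal (Suc m) + 2 * jacobsthal m"

text \<open>Identifies the sizes of the split: \<open>x\<close> is \<open>jacobsthal n\<close> and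
  \<open>y\<close> is \<open>jacobsthal (n - 1)\<close>.\<close>

lemma jacobsthal_closed: "3 * int (jacobsthal m) = 2 ^ m - (-1) ^ m"
  by (induction m rule: jacobsthal.induct) auto

lemma jacobsthal_Suc_even: "even m \<Longrightarrow> jacobsthal (Suc m) = Suc (2 * jacobsthal m)"
  using jacobsthal_closed[of m] jacobsthal_closed[of "Suc m"] by simp

lemma jacobsthal_Suc_odd: "odd m \<Longrightarrow> Suc (jacobsthal (Suc m)) = 2 * jacobsthal m"
  using jacobsthal_closed[of m] jacobsthal_closed[of "Suc m"] by simp

text \<open>The halves of \<open>jacobsthal (m + 2)\<close> are \<open>jacobsthal (m + 1)\<close>
  and \<open>2 * jacobsthal m\<close>, in an order depending on parity. The smaller one counts the
  joining edges; for even \<open>m\<close> it is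
  \<open>2 * jacobsthal m = jacobsthal (m + 1) - 1\<close>, which causes the correction.\<close>

lemma max_edges_jacobsthal_rec:
  "int (max_edges (jacobsthal (Suc (Suc m)))) =
     int (max_edges (jacobsthal (Suc m))) + 2 * int (max_edges (jacobsthal m)) +
     int (jacobsthal m) + int (jacobsthal (Suc m)) - (if even m then 1 else 0)"
proof (cases "even m")
  case True
  then have 1: "jacobsthal (Suc m) = Suc (2 * jacobsthal m)" by (rule jacobsthal_Suc_even)
  have 2: "Suc (jacobsthal (Suc (Suc m))) = 2 * jacobsthal (Suc m)"
    using True by (intro jacobsthal_Suc_odd) simp
  have 3: "jacobsthal (Suc (Suc m)) = Suc (2 * (2 * jacobsthal m))" using 1 2 by simp
  show ?thesis
    unfolding 3 max_edges_odd[of "2 * jacobsthal m"] using True 1 by (simp add: max_edges_even)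
next
  case False
  then have 1: "Suc (jacobsthal (Suc m)) = 2 * jacobsthal m" by (rule jacobsthal_Suc_odd)
  have 2: "jacobsthal (Suc (Suc m)) = Suc (2 * jacobsthal (Suc m))"
    using False by (intro jacobsthal_Suc_even) simp
  show ?thesis
    unfolding 2 max_edges_odd 1 using False by (simp add: max_edges_even)
qed

text \<open>Solves the preceding linear recurrence; the factor 12 keeps the identity
  integral.\<close>

lemma max_edges_jacobsthal:
  "12 * int (max_edges (jacobsthal m)) =
     2 * int m * (2 ^ m - (-1) ^ m) - 2 ^ (m + 2) + 3 + (-1) ^ m"
proof (induction m rule: jacobsthal.induct)
  case (3 m)
  have J: "3 * int (jacobsthal m) = 2 ^ m - (-1) ^ m"
      "3 * int (jacobsthal (Suc m)) = 2 * 2 ^ m + (-1) ^ m"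
    using jacobsthal_closed[of m] jacobsthal_closed[of "Suc m"] by simp_all
  have "12 * int (max_edges (jacobsthal (Suc (Suc m)))) =
      12 * int (max_edges (jacobsthal (Suc m))) + 2 * (12 * int (max_edges (jacobsthal m))) +
      4 * (3 * int (jacobsthal m)) + 4 * (3 * int (jacobsthal (Suc m))) - (if even m then 12 else 0)"
    unfolding max_edges_jacobsthal_rec by (simp add: algebra_simps)
  then show ?case
    unfolding 3 J by (cases "even m") (simp_all add: algebra_simps)
qed simp_all

section \<open>Arcs of the cycle\<close>

text \<open>Measured from its start \<open>j\<close>, an arc is an initial segment of offsets.
  Together with \<open>position_offset\<close> this turns membership into an inequality.\<close>

lemma position_arc_iff:
  assumes "u < N" "k \<le> N"
  shows "(j + u) mod N \<in> position_arc N j k \<longleftrightarrow> u < k"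
proof
  assume "(j + u) mod N \<in> position_arc N j k"
  then obtain t where t: "t < k" "(j + u) mod N = (j + t) mod N"
    by (auto simp: position_arc_def)
  then have "[j + u = j + t] (mod N)" by (simp add: cong_def)
  then have "u mod N = t mod N" by (simp only: cong_add_lcancel_nat) (simp add: cong_def)
  with t assms show "u < k" by simp
qed (auto simp: position_arc_def)

lemma position_offset:
  fixes p N j :: nat
  assumes "p < N"
  obtains u where "u < N" "p = (j + u) mod N"
proof
  \<comment> \<open>The offset is \<open>p - j\<close> modulo \<open>N\<close>, written so that
    natural subtraction does not truncate.\<close>
  show "(p + (N - j mod N)) mod N < N" using assms by simp
  have "j mod N < N" using assms by simp
  then have "(j mod N + (p + (N - j mod N))) mod N = (p + N) mod N" by simp
  then show "p = (j + (p + (N - j mod N)) mod N) mod N"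
    using assms by (metis mod_add_left_eq mod_add_right_eq mod_add_self2 mod_less)
qed

lemma position_arc_subset: "N > 0 \<Longrightarrow> position_arc N j k \<subseteq> {..<N}"
  by (auto simp: position_arc_def)

lemma card_position_arc:
  assumes "k \<le> N"
  shows "card (position_arc N j k) = k"
proof -
  have eq: "position_arc N j k = (\<lambda>t. (j + t) mod N) ` {..<k}"
    by (auto simp: position_arc_def)
  have "inj_on (\<lambda>t. (j + t) mod N) {..<k}"
  proof (rule inj_onI)
    fix s t assume st: "s \<in> {..<k}" "t \<in> {..<k}" "(j + s) mod N = (j + t) mod N"
    then have "[j + s = j + t] (mod N)" by (simp add: cong_def)
    then have "s mod N = t mod N" by (simp only: cong_add_lcancel_nat) (simp add: cong_def)
    with st assms show "s = t" by simp
  qed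
  then show ?thesis using eq by (simp add: card_image)
qed

text \<open>Moving the origin by half the cycle turns the offset \<open>u\<close> into
  \<open>u + M\<close> or \<open>u - M\<close>, which exchanges the two halves.\<close>

lemma position_arc_antipode:
  assumes "N = 2 * M" "p < N"
  shows "p \<in> position_arc N (j + M) M \<longleftrightarrow> p \<notin> position_arc N j M"
proof -
  obtain u where u: "u < N" "p = (j + u) mod N" using position_offset assms(2) .
  have M: "M \<le> N" using assms by simp
  show ?thesis
  proof (cases "u < M")
    case True
    then have "p = (j + M + (u + M)) mod N" using u assms
      by (metis add.assoc add.commute mod_add_self2 mult_2)
    moreover have "u + M < N" "\<not> u + M < M" using True assms by auto
    ultimately show ?thesis using position_arc_iff[of "u + M" N M "j + M"]
      position_arc_iff[of u N M j] M u True by simp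
  next
    case False
    then have "p = (j + M + (u - M)) mod N" using u by simp
    moreover have "u - M < M" "u - M < N" using False u assms by auto
    ultimately show ?thesis using position_arc_iff[of "u - M" N M "j + M"]
      position_arc_iff[of u N M j] M u False by simp
  qed
qed

lemma position_arc_Suc:
  "position_arc N (Suc j) k \<subseteq> insert ((j + k) mod N) (position_arc N j k)"
  "position_arc N j k \<subseteq> insert (j mod N) (position_arc N (Suc j) k)"
proof -
  have "(Suc j + t) mod N \<in> insert ((j + k) mod N) (position_arc N j k)" if "t < k" for t
  proof (cases "Suc t = k")
    case False
    with that show ?thesis
      unfolding position_arc_def by (intro insertI2 CollectI exI[of _ "Suc t"]) auto
  qed auto
  then show "position_arc N (Suc j) k \<subseteq> insert ((j + k) mod N) (position_arc N j k)"
    unfolding position_arc_def[of N "Suc j"] by blast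
  have "(j + t) mod N \<in> insert (j mod N) (position_arc N (Suc j) k)" if "t < k" for t
  proof (cases t)
    case (Suc s)
    with that show ?thesis
      unfolding position_arc_def by (intro insertI2 CollectI exI[of _ s]) auto
  qed auto
  then show "position_arc N j k \<subseteq> insert (j mod N) (position_arc N (Suc j) k)"
    unfolding position_arc_def[of N j] by blast
qed

text \<open>Rotation invariance of the length in \<open>gap_arc\<close>; over the integers the shift
  \<open>j\<close> cancels.\<close>

lemma mod_diff_offsets:
  fixes j s u N :: nat
  assumes "s < N" "u < N"
  shows "((j + u) mod N + N - (j + s) mod N) mod N = (u + N - s) mod N"
proof -
  let ?a = "(j + u) mod N" and ?b = "(j + s) mod N"
  have le: "?b \<le> ?a + N" "s \<le> u + N"
    using assms by (simp_all add: trans_le_add2 less_imp_le)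
  have "int ((?a + N - ?b) mod N) = (int ?a - int ?b + int N) mod int N"
    unfolding of_nat_mod[of "?a + N - ?b"] of_nat_diff[OF le(1)] by (simp add: algebra_simps)
  also have "\<dots> = (int ?a - int ?b) mod int N"
    by (rule mod_add_self2)
  also have "\<dots> = (int (j + u) - int (j + s)) mod int N"
    by (simp only: of_nat_mod mod_diff_eq)
  also have "\<dots> = (int u - int s) mod int N"
    by simp
  also have "\<dots> = (int u - int s + int N) mod int N"
    by (rule mod_add_self2[symmetric])
  also have "\<dots> = int ((u + N - s) mod N)"
    unfolding of_nat_mod of_nat_diff[OF le(2)] by (simp add: algebra_simps)
  finally show ?thesis by simp
qed

text \<open>Going upwards from offset \<open>s\<close> inside an arc to offset \<open>u\<close>
  outside it must cross the gap after the arc's last position.\<close>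

lemma gap_arc_leaves:
  assumes "s < k" "k \<le> u" "u < N"
  shows "(j + k - 1) mod N \<in> gap_arc N ((j + s) mod N) ((j + u) mod N)"
proof -
  have "((j + u) mod N + N - (j + s) mod N) mod N = u - s"
    using mod_diff_offsets[of s N u j] assms mod_add_self2[of "u - s" N] by simp
  moreover have "(j + k - 1) mod N = ((j + s) mod N + (k - 1 - s)) mod N"
    unfolding mod_add_left_eq using assms by simp
  moreover have "k - 1 - s < u - s" using assms by linarith
  ultimately show ?thesis unfolding gap_arc_def by auto
qed

text \<open>Going upwards from outside back into the arc must cross the gap before its first
  position; \<open>j + N - 1\<close> stands for \<open>j - 1\<close> modulo
  \<open>N\<close>.\<close>

lemma gap_arc_enters:
  assumes "s < k" "k \<le> u" "u < N"
  shows "(j + N - 1) mod N \<in> gap_arc N ((j + u) mod N) ((j + s) mod N)"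
proof -
  have "((j + s) mod N + N - (j + u) mod N) mod N = s + N - u"
    using mod_diff_offsets[of u N s j] assms by simp
  moreover have "(j + N - 1) mod N = ((j + u) mod N + (N - 1 - u)) mod N"
    unfolding mod_add_left_eq using assms by simp
  moreover have "N - 1 - u < s + N - u" using assms by linarith
  ultimately show ?thesis unfolding gap_arc_def by auto
qed

section \<open>Cuts at the ends of a diameter\<close>

text \<open>Discrete intermediate value argument: the count changes by at most one per rotation
  step, starts at a value at least \<open>x\<close>, and after \<open>M\<close> steps is at most
  \<open>M - x\<close>, hence at most \<open>x\<close>.\<close>

lemma arc_with_exact_split:
  assumes bij: "bij_betw \<eta> V {..<2 * M}" and W: "W \<subseteq> V" "card W = M" and M: "M > 0"
    and ge: "x \<le> card {v \<in> W. \<eta> v \<in> position_arc (2 * M) j M}" and x: "M \<le> 2 * x"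
  obtains j' where "card {v \<in> W. \<eta> v \<in> position_arc (2 * M) j' M} = x"
proof -
  let ?arc = "\<lambda>k. position_arc (2 * M) k M"
  define f where "f k = card {v \<in> W. \<eta> v \<in> ?arc k}" for k
  have fin: "finite W" using W M by (simp add: card_ge_0_finite)
  have inj: "inj_on \<eta> W" using bij W by (meson bij_betw_def inj_on_subset)
  have step: "card {v \<in> W. \<eta> v \<in> B} \<le> Suc (card {v \<in> W. \<eta> v \<in> C})" if "B \<subseteq> insert c C" for B C c
  proof -
    have "card {v \<in> W. \<eta> v = c} \<le> card {c}"
      using inj by (intro card_inj_on_le[of \<eta>]) (auto simp: inj_on_def)
    moreover have "card {v \<in> W. \<eta> v \<in> B} \<le> card ({v \<in> W. \<eta> v = c} \<union> {v \<in> W. \<eta> v \<in> C})"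
      using that fin by (intro card_mono) auto
    ultimately show ?thesis
      using card_Un_le[of "{v \<in> W. \<eta> v = c}" "{v \<in> W. \<eta> v \<in> C}"] by simp
  qed
  have *: "f (Suc k) \<le> Suc (f k)" "f k \<le> Suc (f (Suc k))" for k
    unfolding f_def by (rule step, rule position_arc_Suc)+
  have "\<eta> v < 2 * M" if "v \<in> W" for v
    using bij W that by (auto simp: bij_betw_def)
  then have "{v \<in> W. \<eta> v \<in> ?arc (j + M)} = W - {v \<in> W. \<eta> v \<in> ?arc j}"
    using position_arc_antipode[of "2 * M" M] by auto
  then have "f (j + M) = M - f j"
    unfolding f_def using W(2) fin by (simp add: card_Diff_subset)
  then have end_le: "f (j + M) \<le> x" using ge x by (simp add: f_def)
  \<comment> \<open>The count is negated because \<open>nat0_intermed_int_val\<close> expects a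
    target between a lower start and a higher end.\<close>
  have "\<exists>k\<le>M. - int (f (j + k)) = - int x"
  proof (rule nat0_intermed_int_val)
    show "\<forall>k<M. \<bar>- int (f (j + (k + 1))) - - int (f (j + k))\<bar> \<le> 1"
    proof (intro allI impI)
      fix k
      show "\<bar>- int (f (j + (k + 1))) - - int (f (j + k))\<bar> \<le> 1"
        using *[of "j + k"] by simp
    qed
  qed (use ge end_le in \<open>simp_all add: f_def\<close>)
  then show ?thesis using that by (auto simp: f_def)
qed

lemma card_half_cube:
  assumes "i \<in> {1..n}" "b \<in> {0, 1}"
  shows "2 * card {v \<in> cube_verts n. v i = b} = card (cube_verts n)"
proof -
  let ?W = "\<lambda>b. {v \<in> cube_verts n. v i = b}"
  have swap: "card {v \<in> ?W 0. flip i v \<in> ?W 1} = card {v \<in> ?W 1. flip i v \<in> ?W 0}"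
    using assms by (intro card_flip_swap) auto
  have "{v \<in> ?W 0. flip i v \<in> ?W 1} = ?W 0" "{v \<in> ?W 1. flip i v \<in> ?W 0} = ?W 1"
    using assms flip_in_cube[of _ n i] by (auto simp: flip_same)
  note swap[unfolded this]
  moreover have "card (cube_verts n) = card (?W 0) + card (?W 1)"
  proof -
    have "cube_verts n = ?W 0 \<union> ?W 1"
      using cube_vertsD assms by blast
    moreover have "card (?W 0 \<union> ?W 1) = card (?W 0) + card (?W 1)"
      by (intro card_Un_disjoint) auto
    ultimately show ?thesis by argo
  qed
  ultimately show ?thesis using assms(2) by auto
qed

text \<open>Passing to the complement \<open>R\<close> in the first subcube gives both isoperimetric
  estimates the same size \<open>y\<close>. Direction \<open>i\<close> adds the vertices of
  \<open>P\<close> not matched into \<open>Q\<close>.\<close>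

lemma sum_boundary_split_ge:
  assumes i: "i \<in> {1..n}" and b: "b \<in> {0, 1}" and S: "S \<subseteq> cube_verts n"
    and y: "card {v \<in> cube_verts n. v i = b \<and> v \<notin> S} = y" "card {v \<in> S. v i \<noteq> b} = y"
  shows "2 * (int (n - 1) * int y - 2 * int (max_edges y)) + int (card {v \<in> S. v i = b}) - int y
    \<le> int (\<Sum>j\<in>{1..n}. card {v \<in> S. flip j v \<notin> S})"
proof -
  define P where "P = {v \<in> S. v i = b}"
  define Q where "Q = {v \<in> S. v i \<noteq> b}"
  define R where "R = {v \<in> cube_verts n. v i = b \<and> v \<notin> S}"
  let ?I = "{1..n} - {i}"
  have sub: "P \<subseteq> cube_verts n" "Q \<subseteq> cube_verts n" "R \<subseteq> cube_verts n"
    using S by (auto simp: P_def Q_def R_def)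
  then have fin: "finite P" "finite Q" "finite R" "finite S"
    using S finite_subset finite_cube_verts by blast+
  have cI: "card ?I = n - 1" using i by simp
  have side: "card {v \<in> S. flip j v \<notin> S} = card {v \<in> R. flip j v \<notin> R} + card {v \<in> Q. flip j v \<notin> Q}"
    if "j \<in> ?I" for j
  proof -
    have j: "j \<in> {1..n}" "i \<noteq> j" using that by auto
    have "{v \<in> S. flip j v \<notin> S} = {v \<in> P. flip j v \<in> R} \<union> {v \<in> Q. flip j v \<notin> Q}"
      using j S flip_in_cube[of _ n j] by (auto simp: P_def Q_def R_def flip_other)
    moreover have "card \<dots> = card {v \<in> P. flip j v \<in> R} + card {v \<in> Q. flip j v \<notin> Q}"
      using fin by (intro card_Un_disjoint) (auto simp: P_def Q_def)
    moreover have "card {v \<in> P. flip j v \<in> R} = card {v \<in> R. flip j v \<in> P}"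
      using sub j by (intro card_flip_swap)
    \<comment> \<open>A flip in direction \<open>j\<close> stays in the subcube
      \<open>v i = b\<close>, which consists of \<open>P\<close> and \<open>R\<close>.\<close>
    moreover have "{v \<in> R. flip j v \<in> P} = {v \<in> R. flip j v \<notin> R}"
      using j flip_in_cube[of _ n j] by (auto simp: P_def R_def flip_other)
    ultimately show ?thesis by simp
  qed
  have "card P \<le> card ({v \<in> S. flip i v \<notin> S} \<union> {v \<in> P. flip i v \<in> Q})"
    using fin b cube_vertsD[OF _ i] S
    by (intro card_mono) (auto simp: P_def Q_def flip_same subset_iff)
  also have "\<dots> \<le> card {v \<in> S. flip i v \<notin> S} + card {v \<in> P. flip i v \<in> Q}"
    by (rule card_Un_le)
  also have "card {v \<in> P. flip i v \<in> Q} = card {v \<in> Q. flip i v \<in> P}"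
    using sub i by (intro card_flip_swap)
  also have "\<dots> \<le> card Q"
    using fin by (intro card_mono) auto
  finally have matching: "card P \<le> card {v \<in> S. flip i v \<notin> S} + y"
    using y(2) by (simp add: Q_def)
  have "(\<Sum>j\<in>{1..n}. card {v \<in> S. flip j v \<notin> S}) = card {v \<in> S. flip i v \<notin> S} +
      (\<Sum>j\<in>?I. card {v \<in> S. flip j v \<notin> S})"
    using i by (intro sum.remove) auto
  also have "(\<Sum>j\<in>?I. card {v \<in> S. flip j v \<notin> S}) =
      (\<Sum>j\<in>?I. card {v \<in> R. flip j v \<notin> R}) + (\<Sum>j\<in>?I. card {v \<in> Q. flip j v \<notin> Q})"
    using side by (simp add: sum.distrib)
  finally have total: "(\<Sum>j\<in>{1..n}. card {v \<in> S. flip j v \<notin> S}) = card {v \<in> S. flip i v \<notin> S} +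
      ((\<Sum>j\<in>?I. card {v \<in> R. flip j v \<notin> R}) + (\<Sum>j\<in>?I. card {v \<in> Q. flip j v \<notin> Q}))" .
  have "int (n - 1) * int y - 2 * int (max_edges y) \<le> int (\<Sum>j\<in>?I. card {v \<in> R. flip j v \<notin> R})"
    using sum_boundary_ge[of ?I n R] sub(3) y(1) cI by (simp add: R_def)
  moreover have "int (n - 1) * int y - 2 * int (max_edges y) \<le> int (\<Sum>j\<in>?I. card {v \<in> Q. flip j v \<notin> Q})"
    using sum_boundary_ge[of ?I n Q] sub(2) y(2) cI by (simp add: Q_def)
  ultimately show ?thesis
    unfolding total of_nat_add using matching by (simp add: P_def)
qed

section \<open>Boundary edges and cuts\<close>

lemma finite_cube_edges [simp]: "finite (cube_edges n)"
  by (rule finite_subset[of _ "Pow (cube_verts n)"]) (auto simp: cube_edges_def)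

lemma flip_edge:
  assumes "v \<in> cube_verts n" "i \<in> {1..n}"
  shows "{v, flip i v} \<in> cube_edges n"
proof -
  have "flip i v i \<noteq> v i" using cube_vertsD[OF assms] by (auto simp: flip_same)
  then have "{k \<in> {1..n}. v k \<noteq> flip i v k} = {i}"
    using assms(2) by (auto simp: flip_def split: if_splits)
  then have "card {k \<in> {1..n}. v k \<noteq> flip i v k} = 1" by simp
  then show ?thesis using assms flip_in_cube unfolding cube_edges_def by blast
qed

lemma flip_inj:
  assumes "v \<in> cube_verts n" "i \<in> {1..n}" "flip i v = flip k v"
  shows "i = k"
proof (rule ccontr)
  assume "i \<noteq> k"
  then have "flip i v i = v i" using assms(3) flip_other by metis
  then show False using cube_vertsD[OF assms(1,2)] by (auto simp: flip_same)
qed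

text \<open>Whichever of its two arcs a boundary edge is given, that arc contains \<open>g\<close>
  or \<open>h\<close>.\<close>

lemma sum_boundary_le_cuts:
  assumes r: "r \<in> routings n \<eta>" and S: "S \<subseteq> cube_verts n"
    and sep: "\<And>v w. v \<in> S \<Longrightarrow> w \<in> cube_verts n - S \<Longrightarrow>
      g \<in> gap_arc (2 ^ n) (\<eta> v) (\<eta> w) \<and> h \<in> gap_arc (2 ^ n) (\<eta> w) (\<eta> v)"
  shows "(\<Sum>i\<in>{1..n}. card {v \<in> S. flip i v \<notin> S}) \<le> gap_cut n r g + gap_cut n r h"
proof -
  let ?D = "SIGMA i:{1..n}. {v \<in> S. flip i v \<notin> S}"
  let ?G = "\<lambda>g. {e \<in> cube_edges n. g \<in> r e}"
  have fin: "finite S" using S finite_subset finite_cube_verts by blast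
  have "(\<lambda>(i, v). {v, flip i v}) ` ?D \<subseteq> ?G g \<union> ?G h"
  proof
    fix e'
    assume "e' \<in> (\<lambda>(i, v). {v, flip i v}) ` ?D"
    then obtain i v where e': "e' = {v, flip i v}"
      and iv: "i \<in> {1..n}" "v \<in> S" "flip i v \<notin> S"
      by auto
    have e: "{v, flip i v} \<in> cube_edges n" using iv S flip_edge by blast
    then have "r {v, flip i v} \<in> arcs_joining (2 ^ n) \<eta> {v, flip i v}"
      using r unfolding routings_def by (rule PiE_mem[rotated])
    then obtain a c where ac: "{v, flip i v} = {a, c}"
        "r {v, flip i v} = gap_arc (2 ^ n) (\<eta> a) (\<eta> c)"
      by (auto simp: arcs_joining_def)
    have "flip i v \<in> cube_verts n - S" using iv S flip_in_cube by blast
    note sep[OF iv(2) this]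
    then show "e' \<in> ?G g \<union> ?G h"
      using ac e unfolding e' by (auto simp: doubleton_eq_iff)
  qed
  \<comment> \<open>Exactly one end of a boundary edge lies in \<open>S\<close>, so the edge
    determines its vertex in \<open>S\<close> and then its direction.\<close>
  moreover have "inj_on (\<lambda>(i, v). {v, flip i v}) ?D"
  proof (rule inj_onI)
    fix p q
    assume "p \<in> ?D" "q \<in> ?D" and eq: "(\<lambda>(i, v). {v, flip i v}) p = (\<lambda>(i, v). {v, flip i v}) q"
    then obtain i v k w where p: "p = (i, v)" "i \<in> {1..n}" "v \<in> S" "flip i v \<notin> S"
      and q: "q = (k, w)" "k \<in> {1..n}" "w \<in> S" "flip k w \<notin> S"
      by blast
    have "{v, flip i v} = {w, flip k w}" using eq p(1) q(1) by simp
    then have "v = w" "flip i v = flip k v" using p q by (auto simp: doubleton_eq_iff)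
    then show "p = q" using flip_inj p q S by blast
  qed
  ultimately have "card ?D \<le> card (?G g \<union> ?G h)"
    by (intro card_inj_on_le) auto
  also have "\<dots> \<le> gap_cut n r g + gap_cut n r h"
    unfolding gap_cut_def by (rule card_Un_le)
  finally show ?thesis using fin by (simp add: card_SigmaI)
qed

lemma sum_boundary_arc_le_cuts:
  assumes r: "r \<in> routings n \<eta>" and \<eta>: "\<eta> ` cube_verts n \<subseteq> {..<2 ^ n}" and k: "k \<le> 2 ^ n"
    and S: "S = {v \<in> cube_verts n. \<eta> v \<in> position_arc (2 ^ n) j k}"
  shows "(\<Sum>i\<in>{1..n}. card {v \<in> S. flip i v \<notin> S}) \<le>
    gap_cut n r ((j + k - 1) mod 2 ^ n) + gap_cut n r ((j + 2 ^ n - 1) mod 2 ^ n)"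
proof (rule sum_boundary_le_cuts[OF r])
  fix v w assume v: "v \<in> S" and w: "w \<in> cube_verts n - S"
  then have lt: "\<eta> v < 2 ^ n" "\<eta> w < 2 ^ n" using \<eta> S by auto
  obtain s where s: "s < 2 ^ n" "\<eta> v = (j + s) mod 2 ^ n" using position_offset lt(1) .
  obtain u where u: "u < 2 ^ n" "\<eta> w = (j + u) mod 2 ^ n" using position_offset lt(2) .
  have "s < k" using v S s position_arc_iff[OF s(1) k, of j] by simp
  moreover have "k \<le> u" using w S u position_arc_iff[OF u(1) k, of j] by auto
  ultimately show "(j + k - 1) mod 2 ^ n \<in> gap_arc (2 ^ n) (\<eta> v) (\<eta> w) \<and>
      (j + 2 ^ n - 1) mod 2 ^ n \<in> gap_arc (2 ^ n) (\<eta> w) (\<eta> v)"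
    unfolding s(2) u(2) using gap_arc_leaves gap_arc_enters u(1) by blast
qed (use S in auto)

section \<open>From individual routings to the cyclic cutwidth\<close>

lemma routings_finite: "finite (routings n \<eta>)"
proof -
  have "finite (arcs_joining N \<eta> e)" if "e \<in> cube_edges n" for e N
  proof -
    have "e \<subseteq> cube_verts n" using that by (auto simp: cube_edges_def)
    then have "finite e" using finite_subset finite_cube_verts by blast
    moreover have "arcs_joining N \<eta> e \<subseteq> (\<lambda>(v, w). gap_arc N (\<eta> v) (\<eta> w)) ` (e \<times> e)"
      by (auto simp: arcs_joining_def)
    ultimately show ?thesis using finite_subset by blast
  qed
  then show ?thesis unfolding routings_def by (intro finite_PiE) auto
qed

lemma routings_nonempty: "routings n \<eta> \<noteq> {}"
proof -
  have "arcs_joining N \<eta> e \<noteq> {}" if "e \<in> cube_edges n" for e N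
    using that by (auto simp: arcs_joining_def cube_edges_def)
  then show ?thesis unfolding routings_def by (simp add: PiE_eq_empty_iff)
qed

lemma cyclic_cutwidth_ge:
  assumes "\<And>r. r \<in> routings n \<eta> \<Longrightarrow> \<exists>j<2 ^ n. c \<le> real (gap_cut n r j)"
  shows "c \<le> real (cyclic_cutwidth n \<eta>)"
proof -
  have "cyclic_cutwidth n \<eta> \<in> (\<lambda>r. Max (gap_cut n r ` {..<2 ^ n})) ` routings n \<eta>"
    unfolding cyclic_cutwidth_def by (intro Min_in) (auto simp: routings_finite routings_nonempty)
  then obtain r where r: "r \<in> routings n \<eta>" "cyclic_cutwidth n \<eta> = Max (gap_cut n r ` {..<2 ^ n})"
    by blast
  obtain j where j: "j < 2 ^ n" "c \<le> real (gap_cut n r j)" using assms r(1) by blast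
  have "gap_cut n r j \<le> cyclic_cutwidth n \<eta>"
    unfolding r(2) using j by (intro Max_ge) auto
  then show ?thesis using j by linarith
qed

theorem theorem1:
  fixes n :: nat and \<eta> :: "(nat \<Rightarrow> nat) \<Rightarrow> nat" and x :: real
  assumes "n \<ge> 2"
    and "bij_betw \<eta> (cube_verts n) {..<2 ^ n}"
    and "x = (2 ^ n + (- 1) ^ (n + 1)) / 3"
    and "\<exists>i\<in>{1..n}. \<exists>b\<in>{0, 1}. \<exists>j<2 ^ n. \<exists>A. A = position_arc (2 ^ n) j (2 ^ (n - 1)) \<and>
           real (card {v \<in> cube_verts n. v i = b \<and> \<eta> v \<in> A}) \<ge> x"
  shows "(\<forall>r\<in>routings n \<eta>. \<exists>j<2 ^ n.
             (odd n \<longrightarrow> real (gap_cut n r j) \<ge> (5 * 2 ^ (n - 2) - 1) / 3) \<and>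
             (even n \<longrightarrow> real (gap_cut n r j) \<ge> (5 * 2 ^ (n - 2) - 2) / 3)) \<and>
         (odd n \<longrightarrow> real (cyclic_cutwidth n \<eta>) \<ge> (5 * 2 ^ (n - 2) - 1) / 3) \<and>
         (even n \<longrightarrow> real (cyclic_cutwidth n \<eta>) \<ge> (5 * 2 ^ (n - 2) - 2) / 3)"
proof -
  define m where "m = n - 1"
  have n: "n = Suc m" "m \<ge> 1" using assms(1) by (auto simp: m_def)
  define y where "y = jacobsthal m"
  define x' where "x' = jacobsthal (Suc m)"
  have Jy: "3 * int y = 2 ^ m - (-1) ^ m" and Jx: "3 * int x' = 2 * 2 ^ m + (-1) ^ m"
    using jacobsthal_closed[of m] jacobsthal_closed[of "Suc m"] by (simp_all add: y_def x'_def)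
  have xy: "x' + y = 2 ^ m"
    using Jx Jy by (simp flip: of_nat_eq_iff[where 'a = int])
  have pow: "(2::int) ^ m \<ge> 2" using n(2) power_increasing[of 1 m "2::int"] by simp
  \<comment> \<open>The difference \<open>x' - y\<close> is
    \<open>(2 ^ m + 2 * (-1) ^ m) / 3\<close>, which is nonnegative for odd \<open>m\<close> because
    \<open>2 ^ m\<close> is at least 2.\<close>
  have "y \<le> x'" using Jx Jy pow by (cases "even m") simp_all
  then have half: "2 ^ m \<le> 2 * x'" using xy by simp
  have N: "(2::nat) ^ n = 2 * 2 ^ m" using n by simp
  have "3 * real x' = 2 * 2 ^ m + (-1) ^ m"
    using arg_cong[OF Jx, of real_of_int] by simp
  then have x: "x = real x'" using assms(3) n by simp
  obtain i b j0 where i: "i \<in> {1..n}" and b: "b \<in> {0, 1}"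
    and ge: "real (card {v \<in> cube_verts n. v i = b \<and> \<eta> v \<in> position_arc (2 ^ n) j0 (2 ^ m)}) \<ge> x"
    using assms(4) unfolding m_def by blast
  define W where "W = {v \<in> cube_verts n. v i = b}"
  have "card (cube_verts n) = 2 ^ n" using bij_betw_same_card[OF assms(2)] by simp
  then have W: "card W = 2 ^ m" "W \<subseteq> cube_verts n"
    using card_half_cube[OF i b] N by (auto simp: W_def)
  have Wc: "{v \<in> W. Q v} = {v \<in> cube_verts n. v i = b \<and> Q v}" for Q
    by (auto simp: W_def)
  obtain j where j: "card {v \<in> W. \<eta> v \<in> position_arc (2 ^ n) j (2 ^ m)} = x'"
    using arc_with_exact_split[OF assms(2)[unfolded N] W(2,1), of x' j0] ge half x
    unfolding N Wc by auto
  define S where "S = {v \<in> cube_verts n. \<eta> v \<in> position_arc (2 ^ n) j (2 ^ m)}"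
  have le: "(2::nat) ^ m \<le> 2 ^ n" using N by simp
  have finS: "finite S" by (simp add: S_def)
  have inj: "inj_on \<eta> S" and img: "\<eta> ` S = position_arc (2 ^ n) j (2 ^ m)"
  proof -
    show "inj_on \<eta> S" using assms(2) by (auto simp: bij_betw_def S_def inj_on_def)
    have "position_arc (2 ^ n) j (2 ^ m) \<subseteq> \<eta> ` cube_verts n"
      using position_arc_subset[of "2 ^ n" j "2 ^ m"] assms(2) by (simp add: bij_betw_def)
    then show "\<eta> ` S = position_arc (2 ^ n) j (2 ^ m)" by (auto simp: S_def)
  qed
  have cS: "card S = 2 ^ m"
    using card_image[OF inj] card_position_arc[OF le] img by simp
  have P: "{v \<in> S. v i = b} = {v \<in> W. \<eta> v \<in> position_arc (2 ^ n) j (2 ^ m)}"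
    by (auto simp: S_def W_def)
  have cP: "card {v \<in> S. v i = b} = x'" unfolding P by (rule j)
  \<comment> \<open>Both \<open>S\<close> and \<open>W\<close> have \<open>2 ^ m = x' + y\<close>
    vertices, so removing the common \<open>x'\<close> leaves \<open>y\<close> from each.\<close>
  have "{v \<in> S. v i \<noteq> b} = S - {v \<in> S. v i = b}" by auto
  then have cQ: "card {v \<in> S. v i \<noteq> b} = y"
    using cS cP finS xy by (simp add: card_Diff_subset)
  have "{v \<in> cube_verts n. v i = b \<and> v \<notin> S} = W - {v \<in> S. v i = b}"
    by (auto simp: W_def)
  moreover have "{v \<in> S. v i = b} \<subseteq> W" by (auto simp: W_def S_def)
  ultimately have cR: "card {v \<in> cube_verts n. v i = b \<and> v \<notin> S} = y"
    using W(1) cP finS xy by (simp add: card_Diff_subset)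
  define D where "D = (\<Sum>k\<in>{1..n}. card {v \<in> S. flip k v \<notin> S})"
  have "2 * (int m * int y - 2 * int (max_edges y)) + int x' - int y \<le> int D"
    using sum_boundary_split_ge[OF i b _ cR cQ] unfolding cP D_def m_def by (auto simp: S_def)
  \<comment> \<open>Scaling by 6 exposes \<open>3 * y\<close>, \<open>3 * x'\<close> and
    \<open>12 * max_edges y\<close>, so the closed forms can be substituted; the terms with factor
    \<open>m\<close> then cancel.\<close>
  then have "2 * (2 * int m * (3 * int y) - 12 * int (max_edges y)) + 2 * (3 * int x') - 2 * (3 * int y)
      \<le> 6 * int D"
    by (simp add: algebra_simps)
  then have "5 * 2 ^ m - 3 + (-1) ^ m \<le> 3 * int D"
    unfolding Jx Jy max_edges_jacobsthal[of m, folded y_def]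
    by (cases "even m") (simp_all add: algebra_simps)
  then have D: "real_of_int (5 * 2 ^ m - 3 + (-1) ^ m) \<le> real_of_int (3 * int D)"
    by (subst of_int_le_iff) simp
  have p2: "(2::real) ^ m = 2 * 2 ^ (n - 2)"
    using n by (cases m) auto
  define c :: real where "c = (5 * 2 ^ (n - 2) - (if odd n then 1 else 2)) / 3"
  \<comment> \<open>The summand \<open>- 3 + (-1) ^ m\<close> is -2 for odd \<open>n\<close> and -4
    for even \<open>n\<close>, twice the constants in \<open>c\<close>.\<close>
  have c: "2 * c \<le> real D"
    using D p2 n(1) by (cases "even m") (simp_all add: c_def)
  have main: "\<exists>g<2 ^ n. c \<le> real (gap_cut n r g)" if r: "r \<in> routings n \<eta>" for r
  proof -
    let ?g = "(j + 2 ^ m - 1) mod 2 ^ n" and ?h = "(j + 2 ^ n - 1) mod 2 ^ n"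
    have "D \<le> gap_cut n r ?g + gap_cut n r ?h"
      unfolding D_def
      by (rule sum_boundary_arc_le_cuts[OF r _ le S_def]) (use assms(2) in \<open>simp add: bij_betw_def\<close>)
    then have "c \<le> real (gap_cut n r ?g) \<or> c \<le> real (gap_cut n r ?h)"
      using c by linarith
    moreover have "?g < 2 ^ n" "?h < 2 ^ n" by simp_all
    ultimately show ?thesis by blast
  qed
  moreover have "c \<le> real (cyclic_cutwidth n \<eta>)"
    using main by (rule cyclic_cutwidth_ge)
  ultimately show ?thesis unfolding c_def by (cases "odd n") simp_all
qed

end
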